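(* For every AG-group $G$, the inner mapping group $\mathrm{Inn}(G)=\{L_0,R_0\}$ is isomorphic to $C_2$, where $0$ denotes the left identity of $G$.
   Context: An AG-group is a set $G$ with a binary operation (written as juxtaposition) such that: (i) $(xy)z=(zy)x$ for all $x,y,z\in G$ (left invertive law); (ii) there exists a left identity $0\in G$, i.e. $0x=x$ for all $x\in G$; (iii) for every $x\in G$ there exists $x^{-1}\in G$ such that $x^{-1}x=xx^{-1}=0$. For $a\in G$, the left and right translations are the maps $L_a,R_a:G\to G$, $L_a(x)=ax$ and $R_a(x)=xa$. The multiplication group $M(G)=\langle L_a,R_a : a\in G\rangle$ is the group generated by all left and right translations under composition of mappings. The inner mapping group $\mathrm{Inn}(G)$ consists of the elements of $M(G)$ that map the left identity $0$ to itself. $C_2$ is the cyclic group of order $2$.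
   Formalization: Inn(G) = {L_0, R_0} is proved for every AG-group, but the isomorphism with C_2 only for non-associative G: in an associative AG-group (an abelian group) L_0 = R_0 is the identity, so Inn(G) is trivial and the claim fails. *)

theory Defs
  imports "HOL-Algebra.Bij" "HOL-Algebra.Generated_Groups" "HOL-Algebra.Elementary_Groups"
begin

text \<open>
  The unit of the record is only a left identity. It is unique: if \<open>e\<close> is another left
  identity, then \<open>\<one> = e \<otimes> \<one> = (e \<otimes> e) \<otimes> \<one> = (\<one> \<otimes> e) \<otimes> e = e\<close>, so taking it from the record
  loses no generality.
\<close>

locale AG_group =
  fixes G (structure)
  assumes m_closed [intro, simp]: "\<lbrakk>x \<in> carrier G; y \<in> carrier G\<rbrakk> \<Longrightarrow> x \<otimes> y \<in> carrier G"
    and left_invertive: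
      "\<lbrakk>x \<in> carrier G; y \<in> carrier G; z \<in> carrier G\<rbrakk> \<Longrightarrow> (x \<otimes> y) \<otimes> z = (z \<otimes> y) \<otimes> x"
    and one_closed [intro, simp]: "\<one> \<in> carrier G"
    and l_one [simp]: "x \<in> carrier G \<Longrightarrow> \<one> \<otimes> x = x"
    and inverse_ex: "x \<in> carrier G \<Longrightarrow> \<exists>y\<in>carrier G. y \<otimes> x = \<one> \<and> x \<otimes> y = \<one>"

definition assoc_on :: "('a, 'b) monoid_scheme \<Rightarrow> bool" where
  "assoc_on G \<longleftrightarrow> (\<forall>x\<in>carrier G. \<forall>y\<in>carrier G. \<forall>z\<in>carrier G.
     (x \<otimes>\<^bsub>G\<^esub> y) \<otimes>\<^bsub>G\<^esub> z = x \<otimes>\<^bsub>G\<^esub> (y \<otimes>\<^bsub>G\<^esub> z))"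

text \<open>
  The translations are restricted to the carrier, since \<^const>\<open>BijGroup\<close> consists of the
  extensional bijections of a set.
\<close>

definition left_translation :: "('a, 'b) monoid_scheme \<Rightarrow> 'a \<Rightarrow> 'a \<Rightarrow> 'a" where
  "left_translation G a = (\<lambda>x\<in>carrier G. a \<otimes>\<^bsub>G\<^esub> x)"

definition right_translation :: "('a, 'b) monoid_scheme \<Rightarrow> 'a \<Rightarrow> 'a \<Rightarrow> 'a" where
  "right_translation G a = (\<lambda>x\<in>carrier G. x \<otimes>\<^bsub>G\<^esub> a)"

definition multiplication_group :: "('a, 'b) monoid_scheme \<Rightarrow> ('a \<Rightarrow> 'a) monoid" where
  "multiplication_group G = (BijGroup (carrier G))
     \<lparr>carrier := generate (BijGroup (carrier G))
        (left_translation G ` carrier G \<union> right_translation G ` carrier G)\<rparr>"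

definition inner_mapping_group :: "('a, 'b) monoid_scheme \<Rightarrow> ('a \<Rightarrow> 'a) monoid" where
  "inner_mapping_group G = (multiplication_group G)
     \<lparr>carrier := {f \<in> carrier (multiplication_group G). f \<one>\<^bsub>G\<^esub> = \<one>\<^bsub>G\<^esub>}\<rparr>"

abbreviation C2 :: "int monoid" where
  "C2 \<equiv> integer_mod_group 2"

text \<open>
  \<^const>\<open>AG_group\<close> includes the abelian groups (the associative case), for which both
  translations by \<open>\<one>\<close> are the identity map. The set \<open>{L\<^sub>\<one>, R\<^sub>\<one>}\<close> is then a
  singleton, so an isomorphism with the group of order two is possible only without associativity.
\<close>

lemma (in AG_group) associative_not_C2:
  assumes "assoc_on G"
    and inn: "carrier (inner_mapping_group G) = {left_translation G \<one>, right_translation G \<one>}"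
  shows "\<not> inner_mapping_group G \<cong> C2"
proof
  assume "inner_mapping_group G \<cong> C2"
  then have "card (carrier (inner_mapping_group G)) = 2"
    by (simp add: iso_same_card carrier_integer_mod_group)
  moreover have "x \<otimes> \<one> = x" if "x \<in> carrier G" for x
  proof -
    have "x \<otimes> \<one> = (x \<otimes> \<one>) \<otimes> \<one>"
      using assms(1) that by (simp add: assoc_on_def)
    also have "\<dots> = x"
      using left_invertive[of x \<one> \<one>] that by simp
    finally show ?thesis .
  qed
  then have "right_translation G \<one> = left_translation G \<one>"
    by (auto simp: left_translation_def right_translation_def)
  ultimately show False
    by (simp add: inn)
qed

end

theory Submission
  imports Defs
begin

text \<open>
  Write \<open>L\<^sub>a\<close> and \<open>R\<^sub>a\<close> for the translations and \<open>x\<^sup>*\<close> for \<open>x \<otimes> \<one>\<close>. The left invertive law gives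
  \<open>x\<^sup>*\<^sup>* = x\<close> and, through the medial law, \<open>a(bx) = b(ax)\<close>. Together with the law itself, these
  two facts make every composite of two translations a single translation:
  \<open>L\<^sub>a L\<^sub>b = L\<^sub>c\<close> and \<open>R\<^sub>a L\<^sub>b = R\<^sub>c\<close> with \<open>c = a\<^sup>*b\<close>, whereas \<open>L\<^sub>a R\<^sub>b = R\<^sub>d\<close> and
  \<open>R\<^sub>a R\<^sub>b = L\<^sub>d\<close> with \<open>d = ab\<close>. Hence the translations already form a group, and the
  multiplication group contains nothing else.
  (Conceptually, \<open>a + b = a\<^sup>*b\<close> is an abelian group, \<open>*\<close> is an automorphism of it whose square
  is the identity, and the multiplication group is made of the maps \<open>x \<mapsto> a + x\<close> and
  \<open>x \<mapsto> a + x\<^sup>*\<close>.)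

  A translation by \<open>a\<close> that fixes \<open>\<one>\<close> satisfies \<open>a\<^sup>* = \<one>\<close> or \<open>a = \<one>\<close>, and the former implies
  \<open>a = \<one>\<^sup>* = \<one>\<close>. So only \<open>L\<^sub>\<one>\<close> and \<open>R\<^sub>\<one>\<close> are inner. The first is the identity and the second has
  square \<open>L\<^sub>\<one>\<close>; they coincide only if \<open>\<one>\<close> is a two-sided identity, and then the left invertive
  law turns into commutativity and associativity.
\<close>

section \<open>Identities in AG-groups\<close>

context AG_group
begin

lemma r_one_r_one: "x \<in> carrier G \<Longrightarrow> (x \<otimes> \<one>) \<otimes> \<one> = x"
  using left_invertive[of x \<one> \<one>] by simp

lemma medial:
  assumes "a \<in> carrier G" "b \<in> carrier G" "c \<in> carrier G" "d \<in> carrier G"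
  shows "(a \<otimes> b) \<otimes> (c \<otimes> d) = (a \<otimes> c) \<otimes> (b \<otimes> d)"
proof -
  have "(a \<otimes> b) \<otimes> (c \<otimes> d) = ((c \<otimes> d) \<otimes> b) \<otimes> a"
    using assms by (intro left_invertive) auto
  also have "(c \<otimes> d) \<otimes> b = (b \<otimes> d) \<otimes> c"
    using assms by (intro left_invertive) auto
  also have "((b \<otimes> d) \<otimes> c) \<otimes> a = (a \<otimes> c) \<otimes> (b \<otimes> d)"
    using assms by (intro left_invertive) auto
  finally show ?thesis .
qed

lemma m_lcomm:
  assumes "a \<in> carrier G" "b \<in> carrier G" "c \<in> carrier G"
  shows "a \<otimes> (b \<otimes> c) = b \<otimes> (a \<otimes> c)"
  using medial[of \<one> a b c] assms by simp

lemma l_mult_l_mult: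
  assumes "a \<in> carrier G" "b \<in> carrier G" "x \<in> carrier G"
  shows "a \<otimes> (b \<otimes> x) = ((a \<otimes> \<one>) \<otimes> b) \<otimes> x"
proof -
  have "((a \<otimes> \<one>) \<otimes> b) \<otimes> x = (x \<otimes> b) \<otimes> (a \<otimes> \<one>)"
    using assms by (intro left_invertive) auto
  also have "\<dots> = a \<otimes> ((x \<otimes> b) \<otimes> \<one>)"
    using assms by (intro m_lcomm) auto
  also have "(x \<otimes> b) \<otimes> \<one> = b \<otimes> x"
    using assms left_invertive[of x b \<one>] by simp
  finally show ?thesis by simp
qed

lemma r_mult_l_mult:
  assumes "a \<in> carrier G" "b \<in> carrier G" "x \<in> carrier G"
  shows "(b \<otimes> x) \<otimes> a = x \<otimes> ((a \<otimes> \<one>) \<otimes> b)"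
proof -
  have "b \<otimes> x = (x \<otimes> b) \<otimes> \<one>"
    using assms left_invertive[of x b \<one>] by simp
  then have "(b \<otimes> x) \<otimes> a = (a \<otimes> \<one>) \<otimes> (x \<otimes> b)"
    using assms left_invertive[of "x \<otimes> b" \<one> a] by simp
  also have "\<dots> = x \<otimes> ((a \<otimes> \<one>) \<otimes> b)"
    using assms by (intro m_lcomm) auto
  finally show ?thesis .
qed

text \<open>
  A two-sided identity makes the operation commutative, as \<open>xy = (\<one>x)y = (yx)\<one> = yx\<close>, and for a
  commutative operation the left invertive law is associativity.
\<close>

lemma assoc_on_if_r_one:
  assumes r_one: "\<And>x. x \<in> carrier G \<Longrightarrow> x \<otimes> \<one> = x"
  shows "assoc_on G"
proof -
  have comm: "x \<otimes> y = y \<otimes> x" if "x \<in> carrier G" "y \<in> carrier G" for x y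
    using left_invertive[of \<one> x y] that by (simp add: r_one)
  have "(x \<otimes> y) \<otimes> z = x \<otimes> (y \<otimes> z)"
    if "x \<in> carrier G" "y \<in> carrier G" "z \<in> carrier G" for x y z
    using left_invertive[of x y z] comm[of "z \<otimes> y" x] comm[of z y] that by simp
  then show ?thesis
    by (simp add: assoc_on_def)
qed

section \<open>The group of translations\<close>

abbreviation L where "L \<equiv> left_translation G"
abbreviation R where "R \<equiv> right_translation G"

lemma compose_translations:
  assumes "a \<in> carrier G" "b \<in> carrier G"
  shows "compose (carrier G) (L a) (L b) = L ((a \<otimes> \<one>) \<otimes> b)"
    and "compose (carrier G) (L a) (R b) = R (a \<otimes> b)"
    and "compose (carrier G) (R a) (L b) = R ((a \<otimes> \<one>) \<otimes> b)"
    and "compose (carrier G) (R a) (R b) = L (a \<otimes> b)"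
  using assms l_mult_l_mult[of a b] m_lcomm[of a _ b] r_mult_l_mult[of a b] left_invertive[of _ b a]
  by (auto simp: compose_def left_translation_def right_translation_def fun_eq_iff)

lemma L_one_apply: "x \<in> carrier G \<Longrightarrow> L \<one> x = x"
  by (simp add: left_translation_def)

lemma translation_inverse_ex:
  assumes "f \<in> L ` carrier G \<union> R ` carrier G"
  shows "\<exists>g \<in> L ` carrier G \<union> R ` carrier G.
    compose (carrier G) g f = L \<one> \<and> compose (carrier G) f g = L \<one>"
  using assms
proof
  assume "f \<in> L ` carrier G"
  then obtain a where a: "a \<in> carrier G" and f: "f = L a" by blast
  obtain b where b: "b \<in> carrier G" "b \<otimes> a = \<one>" "a \<otimes> b = \<one>"
    using inverse_ex[OF a] by blast
  \<comment> \<open>Composing two left translations puts the factor \<open>\<one>\<close> on the left parameter, so the inverse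
    of \<open>L a\<close> is \<open>L (b \<otimes> \<one>)\<close>, not \<open>L b\<close>. Since \<open>x \<mapsto> x \<otimes> \<one>\<close> is an endomorphism, \<open>b \<otimes> \<one>\<close> is
    inverse to \<open>a \<otimes> \<one>\<close>, which is needed for the other order.\<close>
  have "(a \<otimes> \<one>) \<otimes> (b \<otimes> \<one>) = \<one>"
    using medial[of a \<one> b \<one>] a b by simp
  then have "compose (carrier G) (L (b \<otimes> \<one>)) f = L \<one> \<and> compose (carrier G) f (L (b \<otimes> \<one>)) = L \<one>"
    using a b by (simp add: f compose_translations r_one_r_one)
  then show ?thesis
    using b(1) by blast
next
  assume "f \<in> R ` carrier G"
  then obtain a where a: "a \<in> carrier G" and f: "f = R a" by blast
  obtain b where b: "b \<in> carrier G" "b \<otimes> a = \<one>" "a \<otimes> b = \<one>"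
    using inverse_ex[OF a] by blast
  have "compose (carrier G) (R b) f = L \<one> \<and> compose (carrier G) f (R b) = L \<one>"
    using a b by (simp add: f compose_translations)
  then show ?thesis
    using b(1) by blast
qed

text \<open>
  Bijectivity is what makes the product of \<^const>\<open>BijGroup\<close>, which is defined on bijections only,
  agree with composition on translations.
\<close>

lemma translation_Bij:
  assumes f: "f \<in> L ` carrier G \<union> R ` carrier G"
  shows "f \<in> Bij (carrier G)"
proof -
  have maps: "h \<in> carrier G \<rightarrow>\<^sub>E carrier G" if "h \<in> L ` carrier G \<union> R ` carrier G" for h
    using that by (auto simp: left_translation_def right_translation_def)
  obtain g where g: "g \<in> L ` carrier G \<union> R ` carrier G"
    and gf: "compose (carrier G) g f = L \<one>" and fg: "compose (carrier G) f g = L \<one>"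
    using translation_inverse_ex[OF f] by blast
  have gfx: "g (f x) = x" and fgx: "f (g x) = x" if "x \<in> carrier G" for x
    using fun_cong[OF gf, of x] fun_cong[OF fg, of x] that
    by (simp_all add: compose_eq L_one_apply)
  have "bij_betw f (carrier G) (carrier G)"
    using maps[OF f] maps[OF g] by (intro bij_betwI[where g = g]) (auto simp: gfx fgx)
  then show ?thesis
    using maps[OF f] by (auto simp: Bij_def PiE_def)
qed

lemma mult_translations:
  assumes "f \<in> L ` carrier G \<union> R ` carrier G" "g \<in> L ` carrier G \<union> R ` carrier G"
  shows "f \<otimes>\<^bsub>BijGroup (carrier G)\<^esub> g = compose (carrier G) f g"
  using assms translation_Bij by (simp add: BijGroup_def)

text \<open>
  The translations contain \<open>L \<one>\<close>, the identity, and are closed under composition and inverses,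
  so generating a group from them adds nothing.
\<close>

lemma carrier_multiplication_group:
  "carrier (multiplication_group G) = L ` carrier G \<union> R ` carrier G"
proof -
  let ?T = "L ` carrier G \<union> R ` carrier G" and ?B = "BijGroup (carrier G)"
  interpret B: group ?B by (rule group_BijGroup)
  have carrier_B: "carrier ?B = Bij (carrier G)"
    by (simp add: BijGroup_def)
  have one: "\<one>\<^bsub>?B\<^esub> = L \<one>"
    by (auto simp: BijGroup_def left_translation_def)
  have "f \<in> ?T" if "f \<in> generate ?B ?T" for f
    using that
  proof (induction rule: generate.induct)
    case one
    show ?case using \<open>\<one>\<^bsub>?B\<^esub> = L \<one>\<close> by simp
  next
    case (incl h)
    then show ?case .
  next
    case (inv h)
    obtain g where g: "g \<in> ?T" "compose (carrier G) g h = L \<one>"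
      using translation_inverse_ex[OF inv] by blast
    then have "inv\<^bsub>?B\<^esub> h = g"
      using inv translation_Bij one mult_translations
      by (intro B.inv_equality) (simp_all add: carrier_B)
    then show ?case using g(1) by simp
  next
    case (eng f g)
    then show ?case
      by (subst mult_translations) (auto simp: compose_translations)
  qed
  then show ?thesis
    by (auto simp: multiplication_group_def intro: generate.incl)
qed

section \<open>Inner mappings\<close>

lemma carrier_inner_mapping_group: "carrier (inner_mapping_group G) = {L \<one>, R \<one>}"
proof -
  have L_fixes: "L a \<one> = \<one> \<longleftrightarrow> a = \<one>" if "a \<in> carrier G" for a
    using r_one_r_one[OF that] that by (auto simp: left_translation_def)
  have R_fixes: "R a \<one> = \<one> \<longleftrightarrow> a = \<one>" if "a \<in> carrier G" for a
    using that by (simp add: right_translation_def)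
  have "carrier (inner_mapping_group G) = {f \<in> L ` carrier G \<union> R ` carrier G. f \<one> = \<one>}"
    by (simp add: inner_mapping_group_def carrier_multiplication_group)
  also have "\<dots> = {L \<one>, R \<one>}"
    using L_fixes R_fixes by auto
  finally show ?thesis .
qed

lemma mult_inner_mapping_group:
  "L \<one> \<otimes>\<^bsub>inner_mapping_group G\<^esub> L \<one> = L \<one>"
  "L \<one> \<otimes>\<^bsub>inner_mapping_group G\<^esub> R \<one> = R \<one>"
  "R \<one> \<otimes>\<^bsub>inner_mapping_group G\<^esub> L \<one> = R \<one>"
  "R \<one> \<otimes>\<^bsub>inner_mapping_group G\<^esub> R \<one> = L \<one>"
  by (simp_all add: inner_mapping_group_def multiplication_group_def mult_translations
      compose_translations)

lemma assoc_on_if_translations_eq: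
  assumes "L \<one> = R \<one>"
  shows "assoc_on G"
proof (rule assoc_on_if_r_one)
  show "x \<otimes> \<one> = x" if "x \<in> carrier G" for x
    using fun_cong[OF assms, of x] that by (simp add: left_translation_def right_translation_def)
qed

lemma inner_mapping_group_iso_C2:
  assumes "\<not> assoc_on G"
  shows "inner_mapping_group G \<cong> C2"
proof -
  have neq: "R \<one> \<noteq> L \<one>"
    using assms assoc_on_if_translations_eq by metis
  have C2: "carrier C2 = {0, 1}"
    by (auto simp: carrier_integer_mod_group)
  let ?\<phi> = "\<lambda>f. if f = L \<one> then 0 else 1 :: int"
  have "?\<phi> \<in> iso (inner_mapping_group G) C2"
    using neq
    by (auto simp: iso_def hom_def bij_betw_def inj_on_def C2 carrier_inner_mapping_group
        mult_inner_mapping_group mult_integer_mod_group)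
  then show ?thesis
    by (rule is_isoI)
qed

end

theorem theorem4:
  fixes G (structure)
  assumes "AG_group G"
  shows "carrier (inner_mapping_group G) = {left_translation G \<one>, right_translation G \<one>}
    \<and> (\<not> assoc_on G \<longrightarrow> inner_mapping_group G \<cong> C2)"
proof -
  interpret AG_group G by (rule assms)
  show ?thesis
    using carrier_inner_mapping_group inner_mapping_group_iso_C2 by blast
qed

end
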